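(* Let $n\ge 2$ be an integer, let $K\in\mathbb{R}_{\ge 1}$, and let $\mathcal{S}$ be the set of real $n\times n$ matrices $A$ such that $\|A\|_{\infty\to 1}\le K$. Then a matrix $A\in\mathcal{S}$ is determined, up to switching equivalence, by the set $\mathcal{Z}_A$ of measures generated by $A$ relative to the uniform probability vector. That is, for all $A,B\in\mathcal{S}$, if $\mathcal{Z}_A=\mathcal{Z}_B$, then there exists an $n\times n$ permutation matrix $P$ such that $A=PBP^\top$.
   Context: The uniform probability vector is $(1/n,\dots,1/n)\in\mathbb{R}^n$. For a real $n\times n$ matrix $A$ and $\mathbf{x}=(x_i)_i\in\mathbb{R}^n$, let $\mu_{(A,\mathbf{x})}=\sum_{i=1}^n \frac1n\,\delta_{(x_i,(A\mathbf{x})_i)}$, a probability measure on $\mathbb{R}^2$, where $\delta$ denotes the Dirac measure. The set of measures generated by $A$ is $\mathcal{Z}_A=\{\mu_{(A,\mathbf{x})}:\mathbf{x}\in\mathbb{R}^n\}$. For $\mathbf{v}\in\mathbb{R}^n$, $\|\mathbf{v}\|_\infty=\max_i|v_i|$ and $\|\mathbf{v}\|_1=\sum_{i=1}^n\frac1n|v_i|$; the operator norm is $\|A\|_{\infty\to1}=\sup_{\mathbf{v}\ne 0}\|A\mathbf{v}\|_1/\|\mathbf{v}\|_\infty$. Two $n\times n$ matrices $A$ and $B$ are switching equivalent if there exists a permutation matrix $P$ with $A=PBP^\top$. *)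

theory Defs
  imports "HOL-Analysis.Analysis" "HOL-Probability.Probability"
begin

text \<open>The index type \<open>'n\<close> plays the role of \<open>{1, \<dots>, n}\<close>, with \<open>n = CARD('n)\<close>.\<close>

definition generated_measure :: "real ^ 'n ^ 'n \<Rightarrow> real ^ 'n \<Rightarrow> (real \<times> real) measure"
  where "generated_measure A x =
    measure_of UNIV (sets borel)
      (\<lambda>E. \<Sum>i\<in>UNIV. ennreal (1 / real CARD('n)) * emeasure (return borel (x $ i, (A *v x) $ i)) E)"

definition generated_measures :: "real ^ 'n ^ 'n \<Rightarrow> (real \<times> real) measure set"
  where "generated_measures A = {generated_measure A x | x. True}"

text \<open>Normalised by the uniform probability vector, hence the factor \<open>1 / n\<close>.\<close>

definition avg_norm1 :: "real ^ 'n \<Rightarrow> real"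
  where "avg_norm1 v = (\<Sum>i\<in>UNIV. (1 / real CARD('n)) * \<bar>v $ i\<bar>)"

text \<open>The library's \<^const>\<open>infnorm\<close> is the maximum of the absolute values of the coordinates.\<close>

definition opnorm_inf_1 :: "real ^ 'n ^ 'n \<Rightarrow> real"
  where "opnorm_inf_1 A = (SUP v\<in>{v. v \<noteq> 0}. avg_norm1 (A *v v) / infnorm v)"

definition permutation_matrix :: "real ^ 'n ^ 'n \<Rightarrow> bool"
  where "permutation_matrix P \<longleftrightarrow>
    (\<exists>p. p permutes UNIV \<and> P = (\<chi> i j. if j = p i then 1 else 0))"

definition switching_equivalent :: "real ^ 'n ^ 'n \<Rightarrow> real ^ 'n ^ 'n \<Rightarrow> bool"
  where "switching_equivalent A B \<longleftrightarrow>
    (\<exists>P. permutation_matrix P \<and> A = P ** B ** transpose P)"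

text \<open>
  The set function in \<open>generated_measure\<close> is a measure, and the supremum in
  \<open>opnorm_inf_1\<close> is over a nonempty set that is bounded above; so neither definition
  falls back on a default value.
\<close>

lemma space_generated_measure [simp]: "space (generated_measure A x) = UNIV"
  by (simp add: generated_measure_def space_measure_of_conv)

lemma sets_generated_measure [simp, measurable_cong]:
  "sets (generated_measure A x) = sets borel"
  unfolding generated_measure_def
  using sets.sigma_sets_eq[of borel] by (simp add: sets_measure_of_conv)

lemma emeasure_generated_measure:
  fixes A :: "real ^ 'n ^ 'n"
  assumes "E \<in> sets borel"
  shows "emeasure (generated_measure A x) E =
    (\<Sum>i\<in>UNIV. ennreal (1 / real CARD('n)) * emeasure (return borel (x $ i, (A *v x) $ i)) E)"
proof (rule emeasure_measure_of[OF generated_measure_def])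
  let ?\<mu> = "\<lambda>E. \<Sum>i\<in>UNIV. ennreal (1 / real CARD('n)) *
               emeasure (return borel (x $ i, (A *v x) $ i)) E"
  show "positive (sets (generated_measure A x)) ?\<mu>"
    by (simp add: positive_def)
  show "countably_additive (sets (generated_measure A x)) ?\<mu>"
  proof (rule countably_additiveI)
    fix F :: "nat \<Rightarrow> (real \<times> real) set"
    assume F: "range F \<subseteq> sets (generated_measure A x)" "disjoint_family F"
    have "(\<Sum>k. emeasure (return borel z) (F k)) = emeasure (return borel z) (\<Union>k. F k)"
      for z :: "real \<times> real"
      using F by (intro suminf_emeasure) auto
    then show "(\<Sum>k. ?\<mu> (F k)) = ?\<mu> (\<Union>k. F k)"
      by (subst suminf_sum) auto
  qed
  show "E \<in> sets (generated_measure A x)"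
    using assms by simp
qed simp

lemma prob_space_generated_measure:
  fixes A :: "real ^ 'n ^ 'n"
  shows "prob_space (generated_measure A x)"
proof
  have "emeasure (generated_measure A x) (space (generated_measure A x)) =
      (\<Sum>i\<in>(UNIV :: 'n set). ennreal (1 / real CARD('n)))"
    by (simp add: emeasure_generated_measure)
  also have "\<dots> = ennreal (\<Sum>i\<in>(UNIV :: 'n set). 1 / real CARD('n))"
    by (rule sum_ennreal) simp
  also have "\<dots> = 1"
    by simp
  finally show "emeasure (generated_measure A x) (space (generated_measure A x)) = 1" .
qed

lemma opnorm_inf_1_nonempty: "{v :: real ^ 'n. v \<noteq> 0} \<noteq> {}"
proof -
  have "(1 :: real ^ 'n) \<in> {v. v \<noteq> 0}"
    by simp
  then show ?thesis
    by blast
qed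

lemma opnorm_inf_1_bdd_above:
  fixes A :: "real ^ 'n ^ 'n"
  shows "bdd_above ((\<lambda>v. avg_norm1 (A *v v) / infnorm v) ` {v. v \<noteq> 0})"
proof (rule bdd_aboveI2)
  fix v :: "real ^ 'n"
  assume "v \<in> {v. v \<noteq> 0}"
  then have pos: "infnorm v > 0"
    by (simp add: infnorm_pos_lt)
  have row: "\<bar>(A *v v) $ i\<bar> \<le> (\<Sum>j\<in>UNIV. \<bar>A $ i $ j\<bar>) * infnorm v" for i
  proof -
    have "\<bar>(A *v v) $ i\<bar> \<le> (\<Sum>j\<in>UNIV. \<bar>A $ i $ j * v $ j\<bar>)"
      by (simp add: matrix_vector_mult_def)
    also have "\<dots> \<le> (\<Sum>j\<in>UNIV. \<bar>A $ i $ j\<bar> * infnorm v)"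
      unfolding abs_mult by (intro sum_mono mult_left_mono component_le_infnorm_cart) simp
    finally show ?thesis
      by (simp add: sum_distrib_right)
  qed
  have "avg_norm1 (A *v v) \<le>
      (\<Sum>i\<in>UNIV. (1 / real CARD('n)) * (\<Sum>j\<in>UNIV. \<bar>A $ i $ j\<bar>)) * infnorm v"
    unfolding avg_norm1_def sum_distrib_right[of _ _ "infnorm v"] mult.assoc
  proof (intro sum_mono mult_left_mono)
    show "\<bar>(A *v v) $ i\<bar> \<le> (\<Sum>j\<in>UNIV. \<bar>A $ i $ j\<bar> * infnorm v)" for i
      using row by (simp add: sum_distrib_right)
  qed simp
  then show "avg_norm1 (A *v v) / infnorm v \<le>
      (\<Sum>i\<in>UNIV. (1 / real CARD('n)) * (\<Sum>j\<in>UNIV. \<bar>A $ i $ j\<bar>))"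
    using pos by (simp add: pos_divide_le_eq)
qed

end

theory Submission
  imports Defs
begin

text \<open>
  A measure in both sets has the same atoms with the same multiplicities, so for every \<open>x\<close> some
  permutation matrix \<open>P\<close> satisfies \<open>A x = P B P\<^sup>T x\<close>. Thus \<open>\<real>\<^sup>n\<close> is the finite union of the kernels of
  the matrices \<open>A - P B P\<^sup>T\<close>; the kernel of a nonzero matrix is a null set, so one of these
  matrices vanishes.
\<close>

text \<open>Atoms carry all the information: up to the factor \<open>1 / CARD('n)\<close>, the mass
  at \<open>z\<close> is the multiplicity of \<open>z\<close> among the pairs, so the measure
  determines the multiset of pairs.\<close>

lemma emeasure_generated_measure_singleton:
  fixes A :: "real ^ 'n ^ 'n"
  shows "emeasure (generated_measure A x) {z} =
    ennreal (real (card {i. (x $ i, (A *v x) $ i) = z}) / real CARD('n))"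
proof -
  have "emeasure (generated_measure A x) {z} =
      (\<Sum>i\<in>UNIV. ennreal ((1 / real CARD('n)) * indicator {i. (x $ i, (A *v x) $ i) = z} i))"
    by (subst emeasure_generated_measure, simp) (rule sum.cong, auto simp: indicator_def)
  also have "\<dots> = ennreal ((\<Sum>i\<in>UNIV. indicator {i. (x $ i, (A *v x) $ i) = z} i) / real CARD('n))"
    by (subst sum_ennreal) (auto simp: sum_divide_distrib)
  finally show ?thesis
    by (simp add: indicator_def)
qed

lemma generated_measure_eq_imp_permutes:
  fixes A B :: "real ^ 'n ^ 'n"
  assumes "generated_measure A x = generated_measure B y"
  obtains p where "p permutes (UNIV :: 'n set)"
    and "\<And>i. x $ i = y $ p i" and "\<And>i. (A *v x) $ i = (B *v y) $ p i"
proof -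
  let ?f = "\<lambda>i. (x $ i, (A *v x) $ i)" and ?g = "\<lambda>i. (y $ i, (B *v y) $ i)"
  \<comment> \<open>Both masses are nonnegative reals with the same positive denominator, so the
    numerators agree.\<close>
  have "card {i. ?f i = z} = card {i. ?g i = z}" for z
    using emeasure_generated_measure_singleton[of A x z]
      emeasure_generated_measure_singleton[of B y z] assms by simp
  then have "image_mset ?f (mset_set UNIV) = image_mset ?g (mset_set UNIV)"
    by (intro multiset_eqI) (simp add: count_image_mset vimage_def)
  then obtain p where "p permutes UNIV" "\<forall>i\<in>UNIV. ?f i = ?g (p i)"
    by (rule image_mset_eq_implies_permutes[OF finite])
  then show ?thesis
    using that by simp
qed

definition perm_matrix :: "('n \<Rightarrow> 'n) \<Rightarrow> real ^ 'n ^ 'n"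
  where "perm_matrix p = (\<chi> i j. of_bool (j = p i))"

lemma perm_matrix_mult_vec: "(perm_matrix p *v x) $ i = x $ p i"
  by (simp add: perm_matrix_def matrix_vector_mult_def)

lemma transpose_perm_matrix_mult:
  assumes "p permutes UNIV"
  shows "transpose (perm_matrix p) ** perm_matrix p = mat 1"
proof -
  have inj: "inj p"
    using assms by (rule permutes_inj)
  \<comment> \<open>In this order the entry at \<open>(i, j)\<close> is 1 exactly when
    \<open>p i = p j\<close>, so injectivity suffices; a right inverse of a square matrix is also a
    left inverse.\<close>
  have "perm_matrix p ** transpose (perm_matrix p) = mat 1"
    by (simp add: vec_eq_iff perm_matrix_def matrix_matrix_mult_def transpose_def mat_def
        inj_eq[OF inj])
  then show ?thesis
    by (simp add: matrix_left_right_inverse)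
qed

text \<open>Some row of \<open>C\<close> is nonzero, and the kernel lies in the hyperplane
  orthogonal to that row.\<close>

lemma negligible_kernel:
  fixes C :: "real ^ 'n ^ 'm"
  assumes "C \<noteq> 0"
  shows "negligible {x. C *v x = 0}"
proof -
  obtain k where "C $ k \<noteq> 0"
    using assms by (auto simp: vec_eq_iff)
  moreover have "{x. C *v x = 0} \<subseteq> {x. C $ k \<bullet> x = 0}"
    by (auto simp flip: matrix_vector_mul_component)
  ultimately show ?thesis
    using negligible_hyperplane negligible_subset by blast
qed

theorem theorem2:
  fixes K :: real and A B :: "real ^ 'n ^ 'n"
  assumes "CARD('n) \<ge> 2"
    and "K \<ge> 1"
    and "opnorm_inf_1 A \<le> K"
    and "opnorm_inf_1 B \<le> K"
    and "generated_measures A = generated_measures B"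
  shows "switching_equivalent A B"
proof -
  let ?perms = "{p. p permutes (UNIV :: 'n set)}"
  let ?C = "\<lambda>p. A - perm_matrix p ** B ** transpose (perm_matrix p)"
  have "\<exists>p\<in>?perms. ?C p *v x = 0" for x
  proof -
    have "generated_measure A x \<in> generated_measures B"
      using assms(5) by (auto simp: generated_measures_def)
    then obtain y where "generated_measure A x = generated_measure B y"
      by (auto simp: generated_measures_def)
    then obtain p where p: "p permutes UNIV"
      and "\<And>i. x $ i = y $ p i" and "\<And>i. (A *v x) $ i = (B *v y) $ p i"
      by (rule generated_measure_eq_imp_permutes) blast
    then have x: "x = perm_matrix p *v y" and Ax: "A *v x = perm_matrix p *v (B *v y)"
      by (simp_all add: vec_eq_iff perm_matrix_mult_vec)
    \<comment> \<open>The vector \<open>y\<close> depends on \<open>x\<close>; solving for it turns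
      \<open>Ax\<close> into an equation in \<open>x\<close> alone, whose matrix depends only on
      \<open>p\<close>.\<close>
    have "transpose (perm_matrix p) *v x = y"
      by (simp add: x matrix_vector_mul_assoc transpose_perm_matrix_mult[OF p])
    then have "?C p *v x = 0"
      by (simp add: matrix_vector_mult_diff_rdistrib Ax flip: matrix_vector_mul_assoc)
    with p show ?thesis
      by blast
  qed
  then have cover: "(\<Union>p\<in>?perms. {x. ?C p *v x = 0}) = UNIV"
    by blast
  have "\<exists>p\<in>?perms. ?C p = 0"
  proof (rule ccontr)
    assume "\<not> (\<exists>p\<in>?perms. ?C p = 0)"
    \<comment> \<open>There are only finitely many permutations, so null kernels would have a null
      union.\<close>
    then have "negligible (\<Union>p\<in>?perms. {x. ?C p *v x = 0})"
      by (intro negligible_Union finite_imageI finite_permutations)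
        (auto intro: negligible_kernel)
    with cover show False
      by (simp add: non_negligible_UNIV)
  qed
  then show ?thesis
    by (auto simp: switching_equivalent_def permutation_matrix_def perm_matrix_def of_bool_def)
qed

end
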